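(* The generating functions of the Mersenne Lucas polynomials and the Gaussian Mersenne Lucas polynomials are respectively, as identities of formal power series in $z$ with coefficients in $\mathbb{C}[x]$, $$\sum_{n=0}^{\infty}m_n(x)z^n=\frac{2-3xz}{1-3xz+2z^2},$$ $$\sum_{n=0}^{\infty}Gm_n(x)z^n=\frac{4+3ix+\left(i(4-9x^2)-6x\right)z}{2-6xz+4z^2}.$$
   Context: Here $i$ is the imaginary unit. The Mersenne Lucas polynomials are defined by $m_0(x)=2$, $m_1(x)=3x$, $m_n(x)=3x\,m_{n-1}(x)-2m_{n-2}(x)$ for $n\ge2$. The Gaussian Mersenne Lucas polynomials are defined by $Gm_0(x)=2+\frac{3i}{2}x$, $Gm_1(x)=3x+2i$, $Gm_n(x)=3x\,Gm_{n-1}(x)-2Gm_{n-2}(x)$ for $n\ge2$. *)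

theory Defs
  imports Complex_Main "HOL-Computational_Algebra.Polynomial"
    "HOL-Computational_Algebra.Formal_Power_Series"
begin

abbreviation xvar :: "complex poly" where
  "xvar \<equiv> [:0, 1:]"

fun mersenne_lucas :: "nat \<Rightarrow> complex poly" where
  "mersenne_lucas 0 = 2"
| "mersenne_lucas (Suc 0) = 3 * xvar"
| "mersenne_lucas (Suc (Suc n)) =
     3 * xvar * mersenne_lucas (Suc n) - 2 * mersenne_lucas n"

fun gauss_mersenne_lucas :: "nat \<Rightarrow> complex poly" where
  "gauss_mersenne_lucas 0 = 2 + [:3 * \<i> / 2:] * xvar"
| "gauss_mersenne_lucas (Suc 0) = 3 * xvar + [:2 * \<i>:]"
| "gauss_mersenne_lucas (Suc (Suc n)) =
     3 * xvar * gauss_mersenne_lucas (Suc n) - 2 * gauss_mersenne_lucas n"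

(* The library's division of formal power series requires a coefficient type of class
   inverse, which polynomials are not. A quotient by a unit D of a commutative ring is
   the product with its (unique) inverse; the value is meaningful only if D dvd 1. *)
definition unit_quot :: "'a::comm_ring_1 \<Rightarrow> 'a \<Rightarrow> 'a" where
  "unit_quot N D = N * (THE E. D * E = 1)"

lemma unit_quot_eq_iff:
  fixes N D Q :: "'a::comm_ring_1"
  assumes "D dvd 1"
  shows "unit_quot N D = Q \<longleftrightarrow> Q * D = N"
proof -
  obtain E where E: "D * E = 1"
    using assms by (metis dvdE)
  have "(THE E'. D * E' = 1) = E"
    by (rule the_equality) (use E in \<open>metis mult.commute mult.left_commute mult_1_right\<close>)+
  then have "unit_quot N D = N * E"
    by (simp add: unit_quot_def)
  then show ?thesis
    using E by (metis mult.assoc mult.commute mult_1_right)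
qed

end

theory Submission
  imports Defs
begin

text \<open>
  Multiplying the generating function of a sequence by the reversed characteristic polynomial of a
  linear recurrence annihilates every coefficient on which the recurrence acts. For a recurrence of
  order two only the coefficients of \<open>1\<close> and \<open>z\<close> survive, and these are determined by the two initial
  values (\<open>second_order_recurrence_gf\<close>). Both families satisfy the same recurrence, so they share the
  denominator \<open>1 - 3xz + 2z\<^sup>2\<close>; in the Gaussian case numerator and denominator are doubled to clear
  the fraction in the initial value \<open>2 + (3\<i>/2)x\<close>.

  The denominators may be divided by because a power series is a unit as soon as its constant
  coefficient is a unit (\<open>fps_dvd_one_if_nth_0_dvd_one\<close>): here that coefficient is \<open>1\<close> or \<open>2\<close>, the latter
  being invertible among polynomials over the complex numbers.
\<close>

lemma fps_dvd_one_if_nth_0_dvd_one: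
  fixes D :: "'a::comm_ring_1 fps"
  assumes "fps_nth D 0 dvd 1"
  shows "D dvd 1"
proof -
  obtain y where "fps_nth D 0 * y = 1"
    using assms by (metis dvdE)
  then have "D * fps_right_inverse D y = 1"
    by (rule fps_right_inverse)
  then show ?thesis
    by (metis dvdI)
qed

text \<open>
  For \<open>n \<ge> 2\<close>, the coefficient of \<open>z\<^sup>n\<close> in the product is \<open>a n - p * a (n - 1) + q * a (n - 2)\<close>, which is
  zero by the recurrence.
\<close>

lemma second_order_recurrence_gf:
  fixes a :: "nat \<Rightarrow> 'a::comm_ring_1"
  assumes rec: "\<And>n. a (Suc (Suc n)) = p * a (Suc n) - q * a n"
  shows "Abs_fps a * (1 - fps_const p * fps_X + fps_const q * fps_X ^ 2)
           = fps_const (a 0) + fps_const (a 1 - p * a 0) * fps_X"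
proof (rule fps_ext)
  fix n
  have expand: "Abs_fps a * (1 - fps_const p * fps_X + fps_const q * fps_X ^ 2)
      = Abs_fps a - fps_const p * (fps_X * Abs_fps a)
        + fps_const q * (fps_X * (fps_X * Abs_fps a))"
    by (simp add: algebra_simps power2_eq_square)
  consider "n = 0" | "n = 1" | k where "n = Suc (Suc k)"
    by (metis One_nat_def not0_implies_Suc)
  then show "fps_nth (Abs_fps a * (1 - fps_const p * fps_X + fps_const q * fps_X ^ 2)) n
      = fps_nth (fps_const (a 0) + fps_const (a 1 - p * a 0) * fps_X) n"
    unfolding expand by cases (simp_all add: rec)
qed

theorem theorem9:
  shows "1 - fps_const (3 * xvar) * fps_X + 2 * fps_X ^ 2 dvd 1 \<and>
         Abs_fps mersenne_lucas =
           unit_quot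
             (2 - fps_const (3 * xvar) * fps_X)
             (1 - fps_const (3 * xvar) * fps_X + 2 * fps_X ^ 2) \<and>
         2 - fps_const (6 * xvar) * fps_X + 4 * fps_X ^ 2 dvd 1 \<and>
         Abs_fps gauss_mersenne_lucas =
           unit_quot
             (fps_const (4 + [:3 * \<i>:] * xvar)
               + fps_const ([:\<i>:] * (4 - 9 * xvar ^ 2) - 6 * xvar) * fps_X)
             (2 - fps_const (6 * xvar) * fps_X + 4 * fps_X ^ 2)"
    (is "?D dvd 1 \<and> ?M = unit_quot ?N ?D \<and> ?D' dvd 1 \<and> ?G = unit_quot ?N' ?D'")
proof -
  have two: "(2 :: complex poly fps) = fps_const 2"
    by (simp add: numeral_fps_const)
  have D: "?D dvd 1"
    by (rule fps_dvd_one_if_nth_0_dvd_one) (simp add: power2_eq_square mult.assoc)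
  have "(2 :: complex poly) * [:1/2:] = 1"
    by (simp add: numeral_poly one_pCons)
  then have "(2 :: complex poly) dvd 1"
    by (metis dvdI)
  then have D': "?D' dvd 1"
    by (intro fps_dvd_one_if_nth_0_dvd_one)
       (simp add: power2_eq_square mult.assoc fps_numeral_nth)
  have D'_eq: "?D' = ?D * fps_const 2"
    by (rule fps_ext) (simp add: fps_numeral_nth numeral_fps_const algebra_simps)
  have "?M * ?D = fps_const 2 + fps_const (3 * xvar - 3 * xvar * 2) * fps_X"
    using second_order_recurrence_gf[of mersenne_lucas "3 * xvar" 2] by (simp add: two)
  also have "\<dots> = ?N"
    by (rule fps_ext) (simp add: two)
  finally have M: "?M * ?D = ?N" .
  have "?G * ?D = fps_const (2 + [:3 * \<i> / 2:] * xvar)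
      + fps_const (3 * xvar + [:2 * \<i>:] - 3 * xvar * (2 + [:3 * \<i> / 2:] * xvar)) * fps_X"
    using second_order_recurrence_gf[of gauss_mersenne_lucas "3 * xvar" 2] by (simp add: two)
  then have "?G * ?D' = (fps_const (2 + [:3 * \<i> / 2:] * xvar)
      + fps_const (3 * xvar + [:2 * \<i>:] - 3 * xvar * (2 + [:3 * \<i> / 2:] * xvar)) * fps_X)
      * fps_const 2"
    unfolding D'_eq by (simp only: mult.assoc[symmetric])
  also have "\<dots> = ?N'"
    by (rule fps_ext) (simp add: numeral_poly power2_eq_square)
  finally have G: "?G * ?D' = ?N'" .
  show ?thesis
    using D D' M G unit_quot_eq_iff[OF D] unit_quot_eq_iff[OF D'] by metis
qed

end
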